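(* Let $\mathcal H$ be a real Hilbert space, $C\subseteq\mathcal H$ nonempty closed convex, and let $B\colon\mathcal H\to\mathcal H$ be monotone and $L$-Lipschitz ($L>0$) with $S\neq\varnothing$. Let $0\le\beta_k\le\tfrac14$, $\sum_k\beta_k<\infty$, $\theta_k=1-\beta_k$, $x_{-1}=x_0=u_0\in C$, and let $(x_k)$ be defined by $$x_{k+1}=P_C\bigl(x_k-\lambda_kB(u_k)\bigr)\quad(k\ge0),\qquad u_k=x_k+\theta_k(x_k-x_{k-1})+\beta_k(x_k-u_{k-1})\quad(k\ge1),$$ with steps $(\lambda_k)$ generated by the safeguarded ratio rule (defined in the context) and $\sum_k|\lambda_k-\lambda_{k-1}|<\infty$. Assume there exists $K$ with $\lambda_k\le\tfrac1{5L}$ for all $k\ge K$. Then $(x_k)$ converges weakly to a point of $S$, with $\|x_{k+1}-x_k\|\to0$ and $\|u_k-x_k\|\to0$. In particular this holds whenever $\lambda_0\le\tfrac1{5L}$ (take $\omega_k\equiv0$, in which case the assumption holds with $K=0$).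
   Context: $P_C$ is the metric projection onto $C$; monotone means $\langle B(x)-B(y),x-y\rangle\ge0$ for all $x,y\in\mathcal H$; $S=\{z\in C:\langle B(z),x-z\rangle\ge0\ \forall x\in C\}$. Safeguarded ratio rule: fix an initial step $\lambda_0>0$, a constant $0<\kappa\le\tfrac16$, and growth factors $\omega_k\ge0$ with $\sum_k\omega_k<\infty$. With the secant slope $\ell_k=\|B(u_{k+1})-B(u_k)\|/\|u_{k+1}-u_k\|$ (and $\ell_k=0$ if $u_{k+1}=u_k$), set $$\lambda_{k+1}=\min\{\lambda_0,\ \lambda_k(1+\omega_k),\ \kappa/\ell_k\},\qquad k\ge0,$$ where $\kappa/0=+\infty$ (the cut is inactive), and $\lambda_{-1}=\lambda_0$. The order of computation is: $u_{k+1}$ is formed from $x_{k+1},x_k,u_k$, then $B(u_{k+1})$, $\ell_k$, $\lambda_{k+1}$, and then $x_{k+2}$. *)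

theory Defs
  imports "HOL-Analysis.Analysis"
begin

(* The library's closest_point is confined to heine_borel (finite-dimensional) spaces.
   For nonempty closed convex C in a Hilbert space the minimiser exists and is unique. *)
definition metric_proj :: "'a::real_inner set \<Rightarrow> 'a \<Rightarrow> 'a" where
  "metric_proj C x = (THE p. p \<in> C \<and> (\<forall>y\<in>C. dist x p \<le> dist x y))"

definition vi_solutions :: "('a::real_inner \<Rightarrow> 'a) \<Rightarrow> 'a set \<Rightarrow> 'a set" where
  "vi_solutions B C = {z \<in> C. \<forall>x\<in>C. B z \<bullet> (x - z) \<ge> 0}"

definition monotone_operator :: "('a::real_inner \<Rightarrow> 'a) \<Rightarrow> bool" where
  "monotone_operator B \<longleftrightarrow> (\<forall>x y. (B x - B y) \<bullet> (x - y) \<ge> 0)"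

definition weakly_converges :: "(nat \<Rightarrow> 'a::real_inner) \<Rightarrow> 'a \<Rightarrow> bool" where
  "weakly_converges x z \<longleftrightarrow> (\<forall>y. (\<lambda>k. x k \<bullet> y) \<longlonglongrightarrow> z \<bullet> y)"

definition secant_slope :: "('a::real_normed_vector \<Rightarrow> 'a) \<Rightarrow> (nat \<Rightarrow> 'a) \<Rightarrow> nat \<Rightarrow> real" where
  "secant_slope B u k =
    (if u (Suc k) = u k then 0
     else norm (B (u (Suc k)) - B (u k)) / norm (u (Suc k) - u k))"

(* The first case is the convention kappa/0 = infinity; in HOL kappa/0 = 0. *)
definition safeguarded_ratio_rule ::
  "real \<Rightarrow> (nat \<Rightarrow> real) \<Rightarrow> ('a::real_normed_vector \<Rightarrow> 'a) \<Rightarrow> (nat \<Rightarrow> 'a) \<Rightarrow> (nat \<Rightarrow> real) \<Rightarrow> bool" where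
  "safeguarded_ratio_rule \<kappa> \<omega> B u lam \<longleftrightarrow>
    (\<forall>k. lam (Suc k) =
      (if secant_slope B u k = 0 then min (lam 0) (lam k * (1 + \<omega> k))
       else Min {lam 0, lam k * (1 + \<omega> k), \<kappa> / secant_slope B u k}))"

end

theory Submission
  imports Defs
begin

text \<open>With \<open>w\<^sub>k = u\<^sub>k - x\<^sub>k\<close> the extrapolation reads
  \<open>w\<^sub>k = (x\<^sub>k - x\<^sub>k\<^sub>-\<^sub>1) - \<beta>\<^sub>k w\<^sub>k\<^sub>-\<^sub>1\<close>, a summable perturbation of the reflected gradient step
  \<open>u\<^sub>k = 2 x\<^sub>k - x\<^sub>k\<^sub>-\<^sub>1\<close>. For a solution \<open>z\<close>, combining the variational inequalities of two consecutive
  projections shows that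
  \<open>V\<^sub>k = |x\<^sub>k\<^sub>+\<^sub>1 - z|^2 + 4 \<lambda>\<^sub>k \<langle>B z, x\<^sub>k - z\<rangle> + 2/5 |x\<^sub>k\<^sub>+\<^sub>1 - u\<^sub>k|^2 + 1/8 |w\<^sub>k|^2\<close>
  satisfies \<open>V\<^sub>k\<^sub>+\<^sub>1 + G\<^sub>k \<le> (1 + \<beta>\<^sub>k\<^sub>+\<^sub>1) V\<^sub>k\<close> for large \<open>k\<close>, where \<open>G\<^sub>k\<close> collects multiples of the last three
  terms. Hence \<open>|x\<^sub>k - z|\<close> converges and all residuals vanish. Weak compactness is replaced by the
  fact that nested bounded closed convex sets have a common point: the closed convex hulls of the
  tails of \<open>(x\<^sub>k)\<close> intersect only in solutions (Minty), and Opial's argument makes the common point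
  unique and the weak limit.\<close>

section \<open>Nested closed convex sets and the metric projection\<close>

lemma parallelogram_midpoint:
  fixes a b :: "'a::real_inner"
  shows "(norm (a - b))\<^sup>2 = 2 * (norm a)\<^sup>2 + 2 * (norm b)\<^sup>2 - 4 * (norm ((1/2) *\<^sub>R a + (1/2) *\<^sub>R b))\<^sup>2"
  by (simp add: power2_norm_eq_inner inner_simps inner_commute algebra_simps)

text \<open>Near-minimisers of the norm over \<open>K n\<close> form a Cauchy sequence by the parallelogram law.\<close>

lemma nested_closed_convex_Inter_nonempty:
  fixes K :: "nat \<Rightarrow> 'a::{real_inner, complete_space} set"
  assumes ne: "\<And>n. K n \<noteq> {}" and cl: "\<And>n. closed (K n)" and cv: "\<And>n. convex (K n)"
    and dec: "\<And>n. K (Suc n) \<subseteq> K n" and bdd: "bounded (K 0)"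
  shows "\<exists>p. \<forall>n. p \<in> K n"
proof -
  have mono: "K n \<subseteq> K m" if "m \<le> n" for m n
    using lift_Suc_antimono_le[of K, OF dec that] .
  define d where "d n = Inf ((\<lambda>y. (norm y)\<^sup>2) ` K n)" for n
  have bb: "bdd_below ((\<lambda>y. (norm y)\<^sup>2) ` K n)" for n
    by (rule bdd_belowI[of _ 0]) auto
  have d_le: "d n \<le> (norm y)\<^sup>2" if "y \<in> K n" for y n
    unfolding d_def using bb that by (intro cInf_lower) auto
  have d_mono: "incseq d"
  proof (rule incseq_SucI)
    fix n show "d n \<le> d (Suc n)"
      unfolding d_def using bb ne by (intro cInf_superset_mono image_mono dec) auto
  qed
  obtain R where R: "\<And>y. y \<in> K 0 \<Longrightarrow> norm y \<le> R"
    using bdd unfolding bounded_iff by blast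
  have d_bd: "d n \<le> R\<^sup>2" for n
  proof -
    obtain y where y: "y \<in> K n" using ne by blast
    then have "norm y \<le> R" using R mono[of 0 n] by auto
    then show ?thesis using d_le[OF y] power_mono[of "norm y" R 2] by simp
  qed
  obtain D where D: "d \<longlonglongrightarrow> D" and dD: "\<And>n. d n \<le> D"
    using incseq_convergent[OF d_mono] d_bd by metis
  have "\<exists>y\<in>K n. (norm y)\<^sup>2 < d n + inverse (real (Suc n))" for n
  proof -
    have "Inf ((\<lambda>y. (norm y)\<^sup>2) ` K n) < d n + inverse (real (Suc n))"
      by (simp add: d_def)
    from cInf_lessD[OF _ this] ne show ?thesis by auto
  qed
  then obtain m where m: "\<And>n. m n \<in> K n" "\<And>n. (norm (m n))\<^sup>2 < d n + inverse (real (Suc n))"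
    by metis
  \<comment> \<open>The midpoint of \<open>m i\<close> and \<open>m j\<close> lies in the convex set
    \<open>K n\<close>, so its squared norm is at least \<open>d n\<close>, while both endpoints
    have squared norm at most \<open>D + 1/(n+1)\<close>.\<close>
  have close: "(norm (m i - m j))\<^sup>2 \<le> 4 * (D - d n + inverse (real (Suc n)))" if "n \<le> i" "n \<le> j" for i j n
  proof -
    have mem: "m i \<in> K n" "m j \<in> K n" using m mono that by blast+
    have "(1/2) *\<^sub>R m i + (1/2) *\<^sub>R m j \<in> K n"
      using convexD[OF cv mem, of "1/2" "1/2"] by simp
    from d_le[OF this] have mid: "d n \<le> (norm ((1/2) *\<^sub>R m i + (1/2) *\<^sub>R m j))\<^sup>2" .
    have "(norm (m k))\<^sup>2 \<le> D + inverse (real (Suc n))" if "n \<le> k" for k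
    proof -
      have "inverse (real (Suc k)) \<le> inverse (real (Suc n))" using that by (simp add: field_simps)
      then show ?thesis using m(2)[of k] dD[of k] by linarith
    qed
    from this[OF that(1)] this[OF that(2)] mid show ?thesis
      unfolding parallelogram_midpoint[of "m i" "m j"] by (simp add: algebra_simps)
  qed
  have lim0: "(\<lambda>n. 4 * (D - d n + inverse (real (Suc n)))) \<longlonglongrightarrow> 0"
    using tendsto_mult_left[OF tendsto_add[OF tendsto_diff[OF tendsto_const[of D] D] LIMSEQ_inverse_real_of_nat], of 4]
    by simp
  have "Cauchy m"
  proof (rule metric_CauchyI)
    fix e :: real assume e: "0 < e"
    then have "\<forall>\<^sub>F n in sequentially. 4 * (D - d n + inverse (real (Suc n))) < e\<^sup>2"
      using order_tendstoD(2)[OF lim0, of "e\<^sup>2"] by simp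
    then obtain N where N: "4 * (D - d N + inverse (real (Suc N))) < e\<^sup>2"
      by (auto simp: eventually_sequentially)
    have "dist (m i) (m j) < e" if "N \<le> i" "N \<le> j" for i j
    proof -
      have "(norm (m i - m j))\<^sup>2 < e\<^sup>2" using close[OF that] N by linarith
      then show ?thesis using e by (simp add: dist_norm power2_less_imp_less)
    qed
    then show "\<exists>M. \<forall>i\<ge>M. \<forall>j\<ge>M. dist (m i) (m j) < e" by blast
  qed
  then obtain p where p: "m \<longlonglongrightarrow> p" by (auto simp: Cauchy_convergent_iff convergent_def)
  have "p \<in> K n" for n
  proof (rule Lim_in_closed_set[OF cl _ _ p])
    show "\<forall>\<^sub>F k in sequentially. m k \<in> K n"
      using m(1) mono unfolding eventually_sequentially by blast
  qed simp
  then show ?thesis by blast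
qed

text \<open>Justifies the definite description in \<open>metric_proj\<close>. Existence: the sets of
  points of \<open>C\<close> within the infimal distance plus \<open>1/(n+1)\<close> are nested,
  bounded, closed and convex, and a common point is a minimiser.\<close>

lemma metric_proj_minimizer:
  fixes C :: "'a::{real_inner, complete_space} set"
  assumes "C \<noteq> {}" "closed C" "convex C"
  shows "metric_proj C x \<in> C \<and> (\<forall>y\<in>C. dist x (metric_proj C x) \<le> dist x y)"
proof -
  define d where "d = Inf (dist x ` C)"
  have bb: "bdd_below (dist x ` C)" by (rule bdd_belowI[of _ 0]) auto
  have d_le: "d \<le> dist x y" if "y \<in> C" for y
    unfolding d_def using bb that by (intro cInf_lower) auto
  define K where "K n = C \<inter> cball x (d + inverse (real (Suc n)))" for n
  have "\<exists>p. \<forall>n. p \<in> K n"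
  proof (rule nested_closed_convex_Inter_nonempty)
    show "K n \<noteq> {}" for n
    proof -
      have "Inf (dist x ` C) < d + inverse (real (Suc n))" by (simp add: d_def)
      from cInf_lessD[OF _ this] assms(1) obtain y where "y \<in> C" "dist x y < d + inverse (real (Suc n))" by auto
      then have "y \<in> K n" by (simp add: K_def)
      then show ?thesis by blast
    qed
    show "K (Suc n) \<subseteq> K n" for n
    proof -
      have "inverse (real (Suc (Suc n))) \<le> inverse (real (Suc n))" by (simp add: field_simps)
      then have "cball x (d + inverse (real (Suc (Suc n)))) \<subseteq> cball x (d + inverse (real (Suc n)))"
        by (intro subset_cball) linarith
      then show ?thesis unfolding K_def by blast
    qed
  qed (use assms in \<open>auto simp: K_def intro: convex_Int closed_Int bounded_Int\<close>)
  then obtain p where p: "\<And>n. p \<in> K n" by blast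
  have pC: "p \<in> C" using p[of 0] by (simp add: K_def)
  have "(\<lambda>n. d + inverse (real (Suc n))) \<longlonglongrightarrow> d + 0"
    by (intro tendsto_add tendsto_const LIMSEQ_inverse_real_of_nat)
  then have "dist x p \<le> d + 0"
    by (rule LIMSEQ_le_const) (use p in \<open>auto simp: K_def\<close>)
  then have pmin: "\<forall>y\<in>C. dist x p \<le> dist x y" using d_le by force
  \<comment> \<open>Two minimisers are equally far from \<open>x\<close> and their midpoint is no
    nearer, so the parallelogram law forces their distance to be zero.\<close>
  have uniq: "q = p" if q: "q \<in> C \<and> (\<forall>y\<in>C. dist x q \<le> dist x y)" for q
  proof -
    have "(1/2) *\<^sub>R q + (1/2) *\<^sub>R p \<in> C"
      using convexD[OF assms(3), of q p "1/2" "1/2"] q pC by simp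
    then have mid: "dist x p \<le> norm ((1/2) *\<^sub>R (x - q) + (1/2) *\<^sub>R (x - p))"
    proof -
      have "(1/2) *\<^sub>R (x - q) + (1/2) *\<^sub>R (x - p) = x - ((1/2) *\<^sub>R q + (1/2) *\<^sub>R p)"
        unfolding scaleR_right_diff_distrib add_diff_add[symmetric]
        by (simp flip: scaleR_add_left)
      then show ?thesis
        using pmin \<open>(1/2) *\<^sub>R q + (1/2) *\<^sub>R p \<in> C\<close> by (simp add: dist_norm)
    qed
    have eq: "norm (x - q) = norm (x - p)"
      using q pmin pC by (force simp: dist_norm)
    have "(norm (x - p))\<^sup>2 \<le> (norm ((1/2) *\<^sub>R (x - q) + (1/2) *\<^sub>R (x - p)))\<^sup>2"
      using mid by (intro power_mono) (auto simp: dist_norm)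
    then have "(norm ((x - q) - (x - p)))\<^sup>2 \<le> 0"
      unfolding parallelogram_midpoint[of "x - q" "x - p"] eq by linarith
    then show ?thesis by simp
  qed
  have "metric_proj C x = p"
    unfolding metric_proj_def by (rule the_equality) (use pC pmin uniq in blast)+
  with pC pmin show ?thesis by blast
qed

text \<open>If the angle at the projection were acute, a short move towards \<open>y\<close> would
  stay in \<open>C\<close> and come closer to \<open>x\<close>.\<close>

lemma metric_proj_variational:
  fixes C :: "'a::{real_inner, complete_space} set"
  assumes "C \<noteq> {}" "closed C" "convex C" and y: "y \<in> C"
  shows "(metric_proj C x - x) \<bullet> (y - metric_proj C x) \<ge> 0"
proof (rule ccontr)
  let ?p = "metric_proj C x"
  assume "\<not> 0 \<le> (?p - x) \<bullet> (y - ?p)"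
  then have neg: "(x - ?p) \<bullet> (y - ?p) > 0" by (simp add: inner_diff_left)
  have p: "?p \<in> C" "\<And>y. y \<in> C \<Longrightarrow> dist x ?p \<le> dist x y"
    using metric_proj_minimizer[OF assms(1-3)] by auto
  obtain t where t: "0 < t" "t \<le> 1" "dist (?p + t *\<^sub>R (y - ?p)) x < dist ?p x"
    using closer_point_lemma[OF neg] by blast
  have "?p + t *\<^sub>R (y - ?p) \<in> C"
    using convexD_alt[OF assms(3) p(1) y, of t] t by (simp add: algebra_simps)
  from p(2)[OF this] t(3) show False
    by (simp add: dist_commute)
qed

section \<open>Almost decreasing real sequences\<close>

text \<open>The product of the factors \<open>1 + b i\<close> is at most the exponential of their
  sum, so \<open>V\<close> is bounded by some \<open>M\<close>. The multiplicative error then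
  becomes the additive summable error \<open>M * b k\<close>; subtracting its partial sums leaves a
  decreasing sequence \<open>W\<close> bounded below.\<close>

lemma quasi_fejer:
  fixes V g b :: "nat \<Rightarrow> real"
  assumes V: "\<And>k. V k \<ge> 0" and g: "\<And>k. g k \<ge> 0" and b: "\<And>k. b k \<ge> 0" and sb: "summable b"
    and step: "\<And>k. V (Suc k) + g k \<le> (1 + b k) * V k"
  shows "convergent V" and "g \<longlonglongrightarrow> 0"
proof -
  define M where "M = V 0 * exp (suminf b)"
  have "V n \<le> V 0 * exp (\<Sum>i<n. b i)" for n
  proof (induction n)
    case (Suc n)
    have "V (Suc n) \<le> (1 + b n) * V n" using step[of n] g[of n] by linarith
    also have "\<dots> \<le> exp (b n) * (V 0 * exp (\<Sum>i<n. b i))"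
      by (intro mult_mono Suc exp_ge_add_one_self) (use V b in auto)
    finally show ?case by (simp add: exp_add mult_ac)
  qed simp
  moreover have "V 0 * exp (\<Sum>i<n. b i) \<le> M" for n
    unfolding M_def using V sum_le_suminf[OF sb, of "{..<n}"] b by (intro mult_left_mono) auto
  ultimately have VM: "V n \<le> M" for n using order_trans by blast
  have stepM: "V (Suc k) + g k \<le> V k + M * b k" for k
    using step[of k] mult_right_mono[OF VM[of k] b[of k]] by (simp add: algebra_simps)
  define W where "W n = V n - M * (\<Sum>i<n. b i)" for n
  have "decseq W"
  proof (rule decseq_SucI)
    show "W (Suc n) \<le> W n" for n
      using stepM[of n] g[of n] by (simp add: W_def algebra_simps)
  qed
  moreover have "- (M * suminf b) \<le> W n" for n
    using mult_left_mono[OF sum_le_suminf[OF sb, of "{..<n}"], of M] V[of n] b V[of 0] VM[of 0]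
    by (auto simp: W_def)
  ultimately obtain l where "W \<longlonglongrightarrow> l" by (metis decseq_convergent)
  moreover have "(\<lambda>n. M * (\<Sum>i<n. b i)) \<longlonglongrightarrow> M * suminf b"
    by (intro tendsto_intros summable_LIMSEQ sb)
  ultimately have lim: "V \<longlonglongrightarrow> l + M * suminf b"
    using tendsto_add by (fastforce simp: W_def)
  then show "convergent V" by (rule convergentI)
  have "(\<lambda>k. V k - V (Suc k) + M * b k) \<longlonglongrightarrow> (l + M * suminf b) - (l + M * suminf b) + M * 0"
    by (intro tendsto_intros lim LIMSEQ_Suc summable_LIMSEQ_zero sb)
  then have "(\<lambda>k. V k - V (Suc k) + M * b k) \<longlonglongrightarrow> 0" by simp
  from tendsto_sandwich[OF _ _ tendsto_const this, of g] show "g \<longlonglongrightarrow> 0"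
    using g stepM by (simp add: algebra_simps)
qed

section \<open>Weak convergence through closed convex hulls of tails\<close>

text \<open>Points common to all closed tail hulls replace weak cluster points; this is the
  counterpart of the weak closedness of closed convex sets.\<close>

lemma tail_hull_in_closed_convex:
  fixes x :: "nat \<Rightarrow> 'a::real_normed_vector"
  assumes p: "\<And>n. p \<in> closure (convex hull (x ` {n..}))"
    and "closed H" "convex H" and ev: "\<forall>\<^sub>F k in sequentially. x k \<in> H"
  shows "p \<in> H"
proof -
  obtain n where "\<forall>k\<ge>n. x k \<in> H" using ev by (auto simp: eventually_sequentially)
  then have "convex hull (x ` {n..}) \<subseteq> H" by (intro hull_minimal) (use assms in auto)
  then show ?thesis using p[of n] closure_minimal assms(2) by blast
qed

lemma tail_hull_inner_limit:
  fixes x :: "nat \<Rightarrow> 'a::real_inner"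
  assumes p: "\<And>n. p \<in> closure (convex hull (x ` {n..}))"
    and lim: "(\<lambda>k. x k \<bullet> y) \<longlonglongrightarrow> l"
  shows "p \<bullet> y = l"
proof -
  have "\<bar>p \<bullet> y - l\<bar> \<le> e" if "e > 0" for e
  proof -
    have "\<forall>\<^sub>F k in sequentially. \<bar>x k \<bullet> y - l\<bar> < e" using tendstoD[OF lim that] by (simp add: dist_real_def)
    then have "\<forall>\<^sub>F k in sequentially. x k \<in> {v. y \<bullet> v \<le> l + e} \<inter> {v. y \<bullet> v \<ge> l - e}"
      by eventually_elim (auto simp: inner_commute)
    from tail_hull_in_closed_convex[OF p _ _ this]
    have "p \<in> {v. y \<bullet> v \<le> l + e} \<inter> {v. y \<bullet> v \<ge> l - e}"
      by (simp add: closed_halfspace_le closed_halfspace_ge convex_halfspace_le convex_halfspace_ge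
            closed_Int convex_Int)
    then show ?thesis by (auto simp: inner_commute abs_le_iff)
  qed
  then show ?thesis using field_le_epsilon[of "\<bar>p \<bullet> y - l\<bar>" 0] by simp
qed

text \<open>Opial's argument: convergence of the distances to all points of \<open>S\<close> leaves
  room for only one common point of the tail hulls, and every subsequence must share it.\<close>

lemma weakly_converges_if_tail_hulls:
  fixes x :: "nat \<Rightarrow> 'a::{real_inner, complete_space}"
  assumes bdd: "bounded (range x)"
    and cluster: "\<And>p. (\<And>n. p \<in> closure (convex hull (x ` {n..}))) \<Longrightarrow> p \<in> S"
    and conv: "\<And>z. z \<in> S \<Longrightarrow> convergent (\<lambda>k. (norm (x k - z))\<^sup>2)"
  shows "\<exists>z\<in>S. weakly_converges x z"
proof -
  \<comment> \<open>Stated for an arbitrary infinite index set, since it is applied below both to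
    the whole sequence and to a hypothetical bad subsequence.\<close>
  have ex: "\<exists>p. \<forall>n. p \<in> closure (convex hull (x ` (A \<inter> {n..})))" if A: "infinite A" for A
  proof (rule nested_closed_convex_Inter_nonempty)
    show "closure (convex hull x ` (A \<inter> {n..})) \<noteq> {}" for n
      using A infinite_nat_iff_unbounded_le[of A] by fastforce
    show "closure (convex hull x ` (A \<inter> {Suc n..})) \<subseteq> closure (convex hull x ` (A \<inter> {n..}))" for n
      by (intro closure_mono hull_mono image_mono) auto
    show "bounded (closure (convex hull x ` (A \<inter> {0..})))"
      by (intro bounded_closure bounded_convex_hull bounded_subset[OF bdd]) auto
  qed (auto intro: convex_closure)
  from ex[of UNIV] obtain p where p: "\<And>n. p \<in> closure (convex hull (x ` {n..}))" by auto
  \<comment> \<open>The difference of the two squared distances is affine in \<open>x k\<close>, so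
    \<open>x k \<bullet> (p - q)\<close> converges. Both \<open>p\<close> and \<open>q\<close>
    inherit the same limit, hence \<open>p - q\<close> is orthogonal to itself.\<close>
  have uniq: "q = p" if q: "\<And>n. q \<in> closure (convex hull (x ` {n..}))" for q
  proof -
    obtain l1 l2 where "(\<lambda>k. (norm (x k - p))\<^sup>2) \<longlonglongrightarrow> l1" "(\<lambda>k. (norm (x k - q))\<^sup>2) \<longlonglongrightarrow> l2"
      using conv[OF cluster[OF p]] conv[OF cluster[OF q]] by (auto simp: convergent_def)
    then have "(\<lambda>k. ((norm (x k - q))\<^sup>2 - (norm (x k - p))\<^sup>2 + (norm p)\<^sup>2 - (norm q)\<^sup>2) / 2)
       \<longlonglongrightarrow> (l2 - l1 + (norm p)\<^sup>2 - (norm q)\<^sup>2) / 2"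
      by (intro tendsto_intros) auto
    moreover have "((norm (v - q))\<^sup>2 - (norm (v - p))\<^sup>2 + (norm p)\<^sup>2 - (norm q)\<^sup>2) / 2 = v \<bullet> (p - q)" for v
      by (simp add: power2_norm_eq_inner inner_simps inner_commute field_simps)
    ultimately have "(\<lambda>k. x k \<bullet> (p - q)) \<longlonglongrightarrow> (l2 - l1 + (norm p)\<^sup>2 - (norm q)\<^sup>2) / 2" by simp
    from tail_hull_inner_limit[OF p this] tail_hull_inner_limit[OF q this]
    have "(p - q) \<bullet> (p - q) = 0" by (simp add: inner_diff_left)
    then show ?thesis by simp
  qed
  \<comment> \<open>If the bound failed infinitely often, the hulls along those indices would have a
    common point; it equals \<open>p\<close> by uniqueness, yet lies in a half-space excluding
    \<open>p\<close>. The two-sided estimate follows by using \<open>y\<close> and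
    \<open>-y\<close>.\<close>
  have half: "\<forall>\<^sub>F k in sequentially. (x k - p) \<bullet> y < e" if "e > 0" for y e
  proof (rule ccontr)
    assume not: "\<not> (\<forall>\<^sub>F k in sequentially. (x k - p) \<bullet> y < e)"
    define A where "A = {k. (x k - p) \<bullet> y \<ge> e}"
    have "infinite A"
      using not by (auto simp: A_def infinite_nat_iff_unbounded_le eventually_sequentially not_less)
    from ex[OF this] obtain q where q: "\<And>n. q \<in> closure (convex hull (x ` (A \<inter> {n..})))" by blast
    have "closure (convex hull (x ` (A \<inter> {n..}))) \<subseteq> closure (convex hull (x ` {n..}))" for n
      by (intro closure_mono hull_mono image_mono) auto
    with q uniq have "q = p" by blast
    have "closure (convex hull (x ` (A \<inter> {0..}))) \<subseteq> {v. y \<bullet> v \<ge> e + p \<bullet> y}"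
      by (intro closure_minimal hull_minimal closed_halfspace_ge convex_halfspace_ge)
         (auto simp: A_def inner_simps inner_commute)
    with q[of 0] \<open>q = p\<close> \<open>e > 0\<close> show False by (auto simp: inner_commute)
  qed
  have "weakly_converges x p"
    unfolding weakly_converges_def
  proof (intro allI tendstoI)
    fix y and e :: real assume "e > 0"
    from half[OF this, of y] half[OF this, of "-y"]
    show "\<forall>\<^sub>F k in sequentially. dist (x k \<bullet> y) (p \<bullet> y) < e"
      by eventually_elim (auto simp: dist_real_def inner_simps abs_less_iff)
  qed
  with cluster[OF p] show ?thesis by blast
qed

text \<open>Test the weak inequality at \<open>p + t *\<^sub>R (y - p)\<close>, divide by
  \<open>t\<close>, and let \<open>t\<close> tend to 0.\<close>

lemma minty:
  fixes B :: "'a::real_inner \<Rightarrow> 'a"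
  assumes "convex C" and cont: "continuous_on UNIV B" and p: "p \<in> C"
    and weak: "\<And>y. y \<in> C \<Longrightarrow> B y \<bullet> (y - p) \<ge> 0"
  shows "p \<in> vi_solutions B C"
proof -
  have "B p \<bullet> (y - p) \<ge> 0" if y: "y \<in> C" for y
  proof -
    have nonneg: "B (p + t *\<^sub>R (y - p)) \<bullet> (y - p) \<ge> 0" if t: "0 < t" "t \<le> 1" for t
    proof -
      have "p + t *\<^sub>R (y - p) \<in> C"
        using convexD_alt[OF assms(1) p y, of t] t by (simp add: algebra_simps)
      from weak[OF this] t show ?thesis by (simp add: zero_le_mult_iff)
    qed
    have "\<forall>n. B (p + inverse (real (Suc n)) *\<^sub>R (y - p)) \<bullet> (y - p) \<ge> 0"
      by (intro allI nonneg) (simp_all add: inverse_le_1_iff)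
    moreover have "(\<lambda>n. p + inverse (real (Suc n)) *\<^sub>R (y - p)) \<longlonglongrightarrow> p + 0 *\<^sub>R (y - p)"
      by (intro tendsto_intros LIMSEQ_inverse_real_of_nat)
    then have "(\<lambda>n. B (p + inverse (real (Suc n)) *\<^sub>R (y - p))) \<longlonglongrightarrow> B p"
      using cont by (auto simp: continuous_on_eq_continuous_at intro: isCont_tendsto_compose)
    then have "(\<lambda>n. B (p + inverse (real (Suc n)) *\<^sub>R (y - p)) \<bullet> (y - p)) \<longlonglongrightarrow> B p \<bullet> (y - p)"
      by (intro tendsto_intros)
    ultimately show ?thesis by (intro LIMSEQ_le_const) auto
  qed
  with p show ?thesis by (simp add: vi_solutions_def)
qed

section \<open>The one-step Lyapunov inequality\<close>

text \<open>Here \<open>D\<close>, \<open>D2\<close> are the lengths of two consecutive steps, \<open>s0\<close>, \<open>s1\<close> the distances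
  \<open>|x\<^sub>k\<^sub>+\<^sub>1 - u\<^sub>k|\<close>, \<open>w0\<close>, \<open>w1\<close> the norms \<open>|u\<^sub>k - x\<^sub>k|\<close>, \<open>T\<close> the distance of the new iterate from the
  unperturbed reflection, \<open>r\<close> the ratio of the steps, \<open>c = \<lambda> L\<close> and \<open>X = |x\<^sub>k\<^sub>+\<^sub>1 - z|\<close>.\<close>

lemma lyapunov_step_scalar:
  fixes D D2 T s0 s1 w0 w1 X r c b :: real
  assumes nn: "D \<ge> 0" "D2 \<ge> 0" "T \<ge> 0" "s0 \<ge> 0" "s1 \<ge> 0" "w0 \<ge> 0" "w1 \<ge> 0" "X \<ge> 0"
    and r: "\<bar>r - 1\<bar> \<le> 1/100" and b: "0 \<le> b" "b \<le> 1/100" and c: "0 \<le> c" "c \<le> 1/5"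
    and tri: "D2 \<le> s1 + w1" "w1 \<le> D + b * w0" "s1 \<le> T + b * w0"
  shows "(r - 1) * D2\<^sup>2 - r * D\<^sup>2 - r * T\<^sup>2 + 2 * c * ((w1 + s0) * s1) + 2 * c * b * ((w0 + D + X) * w0)
    + 2/5 * s1\<^sup>2 + 1/8 * w1\<^sup>2 + 1/20 * s0\<^sup>2 + 1/20 * w0\<^sup>2
    \<le> b * X\<^sup>2 + 2/5 * s0\<^sup>2 + 1/8 * w0\<^sup>2"
proof -
  have r': "r - 1 \<le> 1/100" "99/100 \<le> r" using r by linarith+
  have sq2: "(p + q)\<^sup>2 \<le> 2 * p\<^sup>2 + 2 * q\<^sup>2" for p q :: real
    using sum_squares_bound[of p q] by (simp add: power2_sum)
  have bw: "(b * w0)\<^sup>2 \<le> 1/10000 * w0\<^sup>2"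
    using mult_right_mono[OF power_mono[OF b(2) b(1), of 2], of "w0\<^sup>2"]
    by (simp add: power_mult_distrib power_divide)
  have 1: "(r - 1) * D2\<^sup>2 \<le> 1/50 * s1\<^sup>2 + 1/50 * w1\<^sup>2"
  proof -
    have "(r - 1) * D2\<^sup>2 \<le> 1/100 * D2\<^sup>2" by (rule mult_right_mono[OF r'(1)]) simp
    moreover have "D2\<^sup>2 \<le> (s1 + w1)\<^sup>2" using tri nn by (intro power_mono) auto
    ultimately show ?thesis using sq2[of s1 w1] by linarith
  qed
  have 2: "w1\<^sup>2 \<le> 2 * D\<^sup>2 + 1/5000 * w0\<^sup>2"
  proof -
    have "w1\<^sup>2 \<le> (D + b * w0)\<^sup>2" using tri nn by (intro power_mono) auto
    then show ?thesis using sq2[of D "b * w0"] bw by linarith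
  qed
  have 3: "s1\<^sup>2 \<le> 101/100 * T\<^sup>2 + 2/100 * w0\<^sup>2"
  proof -
    have "s1\<^sup>2 \<le> (T + b * w0)\<^sup>2" using tri nn by (intro power_mono) auto
    also have "\<dots> = T\<^sup>2 + b * (2 * T * w0) + (b * w0)\<^sup>2" by (simp add: power2_eq_square algebra_simps)
    also have "b * (2 * T * w0) \<le> 1/100 * (2 * T * w0)" using b nn by (intro mult_right_mono) auto
    finally show ?thesis using sum_squares_bound[of T w0] bw zero_le_power2[of w0] by linarith
  qed
  \<comment> \<open>The bound \<open>c \<le> 1/5\<close> enters here as the factor 2/5, followed by
    the arithmetic-geometric mean inequality.\<close>
  have 4: "2 * c * ((w1 + s0) * s1) \<le> 1/5 * w1\<^sup>2 + 1/5 * s0\<^sup>2 + 2/5 * s1\<^sup>2"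
  proof -
    have "2 * c * ((w1 + s0) * s1) \<le> 2/5 * ((w1 + s0) * s1)" using c nn by (intro mult_right_mono) auto
    then show ?thesis using sum_squares_bound[of w1 s1] sum_squares_bound[of s0 s1]
      by (simp add: algebra_simps)
  qed
  \<comment> \<open>\<open>X\<close> is not small, so its square keeps the full factor
    \<open>b\<close>; the factor \<open>1 + b\<close> in front of the Lyapunov function will absorb
    it.\<close>
  have 5: "2 * c * b * ((w0 + D + X) * w0) \<le> b * X\<^sup>2 + 1/500 * D\<^sup>2 + 1/125 * w0\<^sup>2"
  proof -
    have "2 * c * b * ((w0 + D + X) * w0) \<le> 2/5 * b * ((w0 + D + X) * w0)"
      using c b nn by (intro mult_right_mono) auto
    also have "\<dots> = b * (2/5 * ((w0 + D + X) * w0))" by simp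
    also have "\<dots> \<le> b * (X\<^sup>2 + (1/5 * D\<^sup>2 + 4/5 * w0\<^sup>2))"
    proof (rule mult_left_mono[OF _ b(1)])
      have "(w0 + D + X) * w0 = w0\<^sup>2 + D * w0 + X * w0" by (simp add: power2_eq_square algebra_simps)
      then show "2/5 * ((w0 + D + X) * w0) \<le> X\<^sup>2 + (1/5 * D\<^sup>2 + 4/5 * w0\<^sup>2)"
        using sum_squares_bound[of D w0] sum_squares_bound[of X w0] zero_le_power2[of X] by linarith
    qed
    also have "\<dots> \<le> b * X\<^sup>2 + 1/100 * (1/5 * D\<^sup>2 + 4/5 * w0\<^sup>2)"
      using mult_right_mono[OF b(2), of "1/5 * D\<^sup>2 + 4/5 * w0\<^sup>2"] by (simp add: distrib_left)
    finally show ?thesis by (simp add: add_divide_distrib)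
  qed
  have 6: "- (r * D\<^sup>2) \<le> - (99/100 * D\<^sup>2)" "- (r * T\<^sup>2) \<le> - (99/100 * T\<^sup>2)"
    using mult_right_mono[OF r'(2), of "D\<^sup>2"] mult_right_mono[OF r'(2), of "T\<^sup>2"] by simp_all
  \<comment> \<open>The budget: \<open>w1\<^sup>2\<close> collects 0.345 and
    \<open>s1\<^sup>2\<close> collects 0.82. By (2) and (3) this costs about 0.69 of
    \<open>D\<^sup>2\<close> and 0.83 of \<open>T\<^sup>2\<close>, each against the available 0.99.
    The totals for \<open>s0\<^sup>2\<close> and \<open>w0\<^sup>2\<close> are 0.25 and about 0.075,
    below 2/5 and 1/8.\<close>
  show ?thesis
    using 1 2 3 4 5 6 zero_le_power2[of w0] zero_le_power2[of D] zero_le_power2[of s0]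
      zero_le_power2[of s1] zero_le_power2[of T] zero_le_power2[of w1] by linarith
qed

text \<open>The later projection is tested at \<open>z\<close>, the earlier one at \<open>x2\<close>
  and \<open>x0\<close>. Monotonicity disposes of the pair \<open>u1\<close>, \<open>z\<close>; the
  Lipschitz bound controls the remaining differences of \<open>B\<close>, and the scalar lemma
  balances the squares. The weight 4 is what reflection produces: twice
  \<open>2 * (B z \<bullet> (x1 - z))\<close>.\<close>

lemma lyapunov_step:
  fixes B :: "'a::real_inner \<Rightarrow> 'a" and x0 x1 x2 u0 u1 z :: 'a
  assumes mon: "monotone_operator B" and lip: "L-lipschitz_on UNIV B"
    and P1: "(x2 - (x1 - l1 *\<^sub>R B u1)) \<bullet> (z - x2) \<ge> 0"
    and P0a: "(x1 - (x0 - l0 *\<^sub>R B u0)) \<bullet> (x2 - x1) \<ge> 0"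
    and P0b: "(x1 - (x0 - l0 *\<^sub>R B u0)) \<bullet> (x0 - x1) \<ge> 0"
    and w: "u1 - x1 = (x1 - x0) - b *\<^sub>R (u0 - x0)"
    and l: "l0 > 0" "l1 > 0" "l1 * L \<le> 1/5" "\<bar>l1 - l0\<bar> \<le> l0 / 100"
    and b: "0 \<le> b" "b \<le> 1/100"
    and a0: "B z \<bullet> (x0 - z) \<ge> 0"
  shows "((norm (x2 - z))\<^sup>2 + 4 * l1 * (B z \<bullet> (x1 - z)) + 2/5 * (norm (x2 - u1))\<^sup>2 + 1/8 * (norm (u1 - x1))\<^sup>2)
      + (l0 * (B z \<bullet> (x0 - z)) + 1/20 * (norm (x1 - u0))\<^sup>2 + 1/20 * (norm (u0 - x0))\<^sup>2)
    \<le> (1 + b) * ((norm (x1 - z))\<^sup>2 + 4 * l0 * (B z \<bullet> (x0 - z)) + 2/5 * (norm (x1 - u0))\<^sup>2 + 1/8 * (norm (u0 - x0))\<^sup>2)"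
proof -
  \<comment> \<open>\<open>v\<close> is the unperturbed reflection; \<open>r\<close> rescales the
    earlier projection inequality, taken with step \<open>l0\<close>, to the step
    \<open>l1\<close>.\<close>
  define v where "v = x1 + (x1 - x0)"
  define r where "r = l1 / l0"
  have L0: "L \<ge> 0" using lip by (rule lipschitz_on_nonneg)
  have lipB: "norm (B p - B q) \<le> L * norm (p - q)" for p q
    using lipschitz_onD[OF lip, of p q] by (simp add: dist_norm)
  have u1: "u1 = v - b *\<^sub>R (u0 - x0)" using w by (simp add: v_def algebra_simps)
  have P1': "(norm (x2 - z))\<^sup>2 \<le> (norm (x1 - z))\<^sup>2 - (norm (x2 - x1))\<^sup>2 - 2 * (l1 * (B u1 \<bullet> (x2 - z)))"
    using P1 by (simp add: power2_norm_eq_inner inner_simps inner_commute algebra_simps)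
  \<comment> \<open>Pass from \<open>x2 - z\<close> through \<open>u1\<close> and use
    \<open>u1 - z = 2(x1 - z) - (x0 - z) - b(u0 - x0)\<close>; the two contributions of size
    \<open>b\<close> combine into a difference of \<open>B\<close>, to which the Lipschitz bound
    applies.\<close>
  have "B u1 \<bullet> (x2 - z) = - ((B u1 - B u0) \<bullet> (u1 - x2)) - B u0 \<bullet> (v - x2)
      - b * ((B z - B u0) \<bullet> (u0 - x0)) + (B u1 - B z) \<bullet> (u1 - z)
      + 2 * (B z \<bullet> (x1 - z)) - B z \<bullet> (x0 - z)"
    unfolding u1 v_def by (simp add: inner_simps inner_commute algebra_simps)
  moreover have "(B u1 - B z) \<bullet> (u1 - z) \<ge> 0" using mon by (simp add: monotone_operator_def)
  ultimately have "- ((B u1 - B u0) \<bullet> (u1 - x2)) - B u0 \<bullet> (v - x2)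
      - b * ((B z - B u0) \<bullet> (u0 - x0)) + 2 * (B z \<bullet> (x1 - z)) - B z \<bullet> (x0 - z) \<le> B u1 \<bullet> (x2 - z)"
    by linarith
  from mult_left_mono[OF this less_imp_le[OF l(2)]] P1'
  have main: "(norm (x2 - z))\<^sup>2 \<le> (norm (x1 - z))\<^sup>2 - (norm (x2 - x1))\<^sup>2
      + 2 * l1 * ((B u1 - B u0) \<bullet> (u1 - x2)) + 2 * l1 * (B u0 \<bullet> (v - x2))
      + 2 * l1 * b * ((B z - B u0) \<bullet> (u0 - x0)) - 4 * l1 * (B z \<bullet> (x1 - z)) + 2 * l1 * (B z \<bullet> (x0 - z))"
    by (simp add: distrib_left right_diff_distrib)
  \<comment> \<open>Adding the two tests of the earlier projection gives the direction
    \<open>x2 - v\<close>; since \<open>x2 - x1 = (x2 - v) + (x1 - x0)\<close>, the inner product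
    becomes a difference of squares.\<close>
  have "2 * (l0 * (B u0 \<bullet> (v - x2))) \<le> (norm (x2 - x1))\<^sup>2 - (norm (x1 - x0))\<^sup>2 - (norm (x2 - v))\<^sup>2"
    using P0a P0b by (simp add: v_def power2_norm_eq_inner inner_simps inner_commute algebra_simps)
  then have "r * (2 * (l0 * (B u0 \<bullet> (v - x2)))) \<le> r * ((norm (x2 - x1))\<^sup>2 - (norm (x1 - x0))\<^sup>2 - (norm (x2 - v))\<^sup>2)"
    using l by (intro mult_left_mono) (auto simp: r_def)
  then have t1: "2 * l1 * (B u0 \<bullet> (v - x2)) \<le> r * (norm (x2 - x1))\<^sup>2 - r * (norm (x1 - x0))\<^sup>2 - r * (norm (x2 - v))\<^sup>2"
    using l by (simp add: r_def right_diff_distrib)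
  have t2: "2 * l1 * ((B u1 - B u0) \<bullet> (u1 - x2)) \<le> 2 * (l1 * L) * ((norm (u1 - x1) + norm (x1 - u0)) * norm (x2 - u1))"
  proof -
    have "(B u1 - B u0) \<bullet> (u1 - x2) \<le> norm (B u1 - B u0) * norm (u1 - x2)" by (rule norm_cauchy_schwarz)
    also have "\<dots> \<le> (L * (norm (u1 - x1) + norm (x1 - u0))) * norm (x2 - u1)"
      using order_trans[OF lipB mult_left_mono[OF _ L0], of u1 u0 "norm (u1 - x1) + norm (x1 - u0)"]
        norm_triangle_ineq[of "u1 - x1" "x1 - u0"]
      by (simp add: norm_minus_commute[of u1 x2] mult_right_mono)
    finally have "(2 * l1) * ((B u1 - B u0) \<bullet> (u1 - x2))
        \<le> (2 * l1) * ((L * (norm (u1 - x1) + norm (x1 - u0))) * norm (x2 - u1))"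
      using l(2) by (intro mult_left_mono) auto
    then show ?thesis by (simp only: mult_ac)
  qed
  have t3: "2 * l1 * b * ((B z - B u0) \<bullet> (u0 - x0))
      \<le> 2 * (l1 * L) * b * ((norm (u0 - x0) + norm (x1 - x0) + norm (x1 - z)) * norm (u0 - x0))"
  proof -
    \<comment> \<open>The route from \<open>u0\<close> to \<open>z\<close> goes through
      \<open>x0\<close> and \<open>x1\<close>, because the Lyapunov function contains the distance
      of \<open>x1\<close> to \<open>z\<close>.\<close>
    have n: "norm (z - u0) \<le> norm (u0 - x0) + norm (x1 - x0) + norm (x1 - z)"
      using norm_triangle_ineq[of "(x0 - u0) + (x1 - x0)" "z - x1"] norm_triangle_ineq[of "x0 - u0" "x1 - x0"]
      by (simp add: norm_minus_commute algebra_simps)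
    have "(B z - B u0) \<bullet> (u0 - x0) \<le> norm (B z - B u0) * norm (u0 - x0)" by (rule norm_cauchy_schwarz)
    also have "\<dots> \<le> (L * (norm (u0 - x0) + norm (x1 - x0) + norm (x1 - z))) * norm (u0 - x0)"
      using order_trans[OF lipB mult_left_mono[OF n L0]] by (simp add: mult_right_mono)
    finally have "(2 * l1 * b) * ((B z - B u0) \<bullet> (u0 - x0))
        \<le> (2 * l1 * b) * ((L * (norm (u0 - x0) + norm (x1 - x0) + norm (x1 - z))) * norm (u0 - x0))"
      using l b by (intro mult_left_mono) auto
    then show ?thesis by (simp only: mult_ac)
  qed
  have n1: "norm (x2 - x1) \<le> norm (x2 - u1) + norm (u1 - x1)"
    using norm_triangle_ineq[of "x2 - u1" "u1 - x1"] by simp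
  have n2: "norm (u1 - x1) \<le> norm (x1 - x0) + b * norm (u0 - x0)"
    unfolding w using norm_triangle_ineq4[of "x1 - x0" "b *\<^sub>R (u0 - x0)"] b by simp
  have n3: "norm (x2 - u1) \<le> norm (x2 - v) + b * norm (u0 - x0)"
    unfolding u1 diff_diff_eq2 add_diff_eq[symmetric]
    using norm_triangle_ineq[of "x2 - v" "b *\<^sub>R (u0 - x0)"] b by (simp add: add_diff_eq diff_add_eq)
  have r1: "\<bar>r - 1\<bar> \<le> 1/100"
  proof -
    have "r - 1 = (l1 - l0) / l0" using l(1) by (simp add: r_def diff_divide_distrib)
    then show ?thesis using l(1,4) by (simp add: abs_divide pos_divide_le_eq)
  qed
  have l1L: "0 \<le> l1 * L" using l L0 by simp
  note sc = lyapunov_step_scalar[where D = "norm (x1 - x0)" and ?s0.0 = "norm (x1 - u0)" and X = "norm (x1 - z)",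
      OF norm_ge_zero norm_ge_zero norm_ge_zero norm_ge_zero norm_ge_zero norm_ge_zero norm_ge_zero norm_ge_zero
      r1 b l1L l(3) n1 n2 n3]
  have t4: "2 * l1 * (B z \<bullet> (x0 - z)) + l0 * (B z \<bullet> (x0 - z)) \<le> 4 * l0 * (B z \<bullet> (x0 - z))"
  proof -
    have "2 * l1 + l0 \<le> 4 * l0" using l(1,4) by linarith
    from mult_right_mono[OF this a0] show ?thesis by (simp add: distrib_right)
  qed
  have t5: "0 \<le> b * (4 * l0 * (B z \<bullet> (x0 - z)) + 2/5 * (norm (x1 - u0))\<^sup>2 + 1/8 * (norm (u0 - x0))\<^sup>2)"
    using b l a0 by (intro mult_nonneg_nonneg add_nonneg_nonneg) auto
  have "(r - 1) * (norm (x2 - x1))\<^sup>2 = r * (norm (x2 - x1))\<^sup>2 - (norm (x2 - x1))\<^sup>2"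
    by (simp add: left_diff_distrib)
  moreover have "(1 + b) * ((norm (x1 - z))\<^sup>2 + F) = (norm (x1 - z))\<^sup>2 + F + b * (norm (x1 - z))\<^sup>2 + b * F" for F
    by (simp add: distrib_left distrib_right)
  note this[of "4 * l0 * (B z \<bullet> (x0 - z)) + 2/5 * (norm (x1 - u0))\<^sup>2 + 1/8 * (norm (u0 - x0))\<^sup>2", folded add.assoc]
  ultimately show ?thesis
    using main t1 t2 t3 t4 t5 sc[folded add.assoc] by linarith
qed

section \<open>Bounds on the generated steps\<close>

lemma secant_slope_bounds:
  assumes "L-lipschitz_on UNIV B"
  shows "0 \<le> secant_slope B u k" "secant_slope B u k \<le> L"
  using lipschitz_onD[OF assms, of "u (Suc k)" "u k"] lipschitz_on_nonneg[OF assms]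
  by (auto simp: secant_slope_def dist_norm pos_divide_le_eq)

text \<open>A secant slope never exceeds \<open>L\<close>, so an active cut is at least
  \<open>\<kappa> / L\<close>, and the factor \<open>1 + \<omega> k\<close> never shrinks a
  step.\<close>

lemma safeguarded_ratio_rule_lower_bound:
  assumes rule: "safeguarded_ratio_rule \<kappa> \<omega> B u lam" and lip: "L-lipschitz_on UNIV B"
    and "L > 0" "lam 0 > 0" "\<kappa> > 0" and \<omega>: "\<And>k. 0 \<le> \<omega> k"
  shows "min (lam 0) (\<kappa> / L) \<le> lam k"
proof (induction k)
  case (Suc k)
  let ?m = "min (lam 0) (\<kappa> / L)"
  have "0 < ?m" using assms by simp
  then have "lam k * 1 \<le> lam k * (1 + \<omega> k)" using Suc \<omega> by (intro mult_left_mono) auto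
  then have grow: "?m \<le> lam k * (1 + \<omega> k)" using Suc by linarith
  show ?case
  proof (cases "secant_slope B u k = 0")
    case True
    then show ?thesis using rule grow by (simp add: safeguarded_ratio_rule_def)
  next
    case False
    then have "0 < secant_slope B u k" "secant_slope B u k \<le> L"
      using secant_slope_bounds[OF lip, of u k] by auto
    then have "\<kappa> / L \<le> \<kappa> / secant_slope B u k"
      using \<open>\<kappa> > 0\<close> by (intro divide_left_mono) auto
    then show ?thesis using rule grow False by (auto simp: safeguarded_ratio_rule_def)
  qed
qed simp

lemma safeguarded_ratio_rule_decseq:
  assumes "safeguarded_ratio_rule \<kappa> \<omega> B u lam" and "\<And>k. \<omega> k = 0"
  shows "decseq lam"
  using assms by (intro decseq_SucI) (auto simp: safeguarded_ratio_rule_def)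

lemma decseq_bounded_below_summable_abs_diff:
  fixes a :: "nat \<Rightarrow> real"
  assumes "decseq a" and "\<And>k. m \<le> a k"
  shows "summable (\<lambda>k. \<bar>a (Suc k) - a k\<bar>)"
proof -
  obtain l where "a \<longlonglongrightarrow> l" using assms by (metis decseq_convergent)
  then have "summable (\<lambda>k. a k - a (Suc k))" using telescope_summable' by blast
  moreover have "a k - a (Suc k) = \<bar>a (Suc k) - a k\<bar>" for k
    using decseqD[OF assms(1), of k "Suc k"] by simp
  ultimately show ?thesis by simp
qed

section \<open>Convergence of the perturbed reflected projection method\<close>

lemma sum_tendsto_zero_split:
  fixes f g :: "nat \<Rightarrow> real"
  assumes "(\<lambda>k. f k + g k) \<longlonglongrightarrow> 0" and "\<And>k. 0 \<le> f k" "\<And>k. 0 \<le> g k"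
  shows "f \<longlonglongrightarrow> 0" "g \<longlonglongrightarrow> 0"
  using tendsto_sandwich[OF _ _ tendsto_const assms(1), of f]
    tendsto_sandwich[OF _ _ tendsto_const assms(1), of g] assms(2,3) by simp_all

lemma norm_square_tendsto_zero:
  assumes "(\<lambda>k. c * (norm (f k))\<^sup>2) \<longlonglongrightarrow> 0" and "c \<noteq> 0"
  shows "(\<lambda>k. norm (f k)) \<longlonglongrightarrow> 0"
  using tendsto_real_sqrt[OF tendsto_mult_left[OF assms(1), of "inverse c"]] assms(2)
  by (simp flip: mult.assoc)

text \<open>The convergence argument separated from the step rule: steps enter only through a
  positive lower bound, the eventual bound \<open>1 / (5 * L)\<close> and vanishing
  increments.\<close>

lemma reflected_projection_weakly_converges:
  fixes B :: "'a::{real_inner, complete_space} \<Rightarrow> 'a"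
    and C :: "'a set" and x u :: "nat \<Rightarrow> 'a" and \<beta> lam :: "nat \<Rightarrow> real"
  assumes C: "C \<noteq> {}" "closed C" "convex C"
    and mon: "monotone_operator B" and L: "L > 0" and lip: "L-lipschitz_on UNIV B"
    and S: "vi_solutions B C \<noteq> {}"
    and \<beta>: "\<And>k. 0 \<le> \<beta> k" "summable \<beta>"
    and x0: "x 0 \<in> C"
    and x: "\<And>k. x (Suc k) = metric_proj C (x k - lam k *\<^sub>R B (u k))"
    and w: "\<And>k. u (Suc k) - x (Suc k) = (x (Suc k) - x k) - \<beta> (Suc k) *\<^sub>R (u k - x k)"
    and lam: "m > 0" "\<And>k. m \<le> lam k" "\<forall>\<^sub>F k in sequentially. lam k \<le> 1 / (5 * L)"
      "(\<lambda>k. lam (Suc k) - lam k) \<longlonglongrightarrow> 0"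
  shows "(\<exists>z\<in>vi_solutions B C. weakly_converges x z)
          \<and> (\<lambda>k. norm (x (Suc k) - x k)) \<longlonglongrightarrow> 0
          \<and> (\<lambda>k. norm (u k - x k)) \<longlonglongrightarrow> 0"
proof -
  let ?S = "vi_solutions B C"
  have xC: "x k \<in> C" for k
    using x0 x metric_proj_minimizer[OF C] by (cases k) auto
  have proj: "(x (Suc k) - (x k - lam k *\<^sub>R B (u k))) \<bullet> (y - x (Suc k)) \<ge> 0" if "y \<in> C" for k y
    unfolding x by (rule metric_proj_variational[OF C that])
  have lam0: "lam k > 0" for k using lam(1,2) less_le_trans by blast
  \<comment> \<open>As \<open>m \<le> lam k\<close>, the absolute threshold \<open>m / 100\<close>
    yields the relative bound required by \<open>lyapunov_step\<close>.\<close>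
  have "\<forall>\<^sub>F k in sequentially. dist (lam (Suc k) - lam k) 0 < m / 100"
    using tendstoD[OF lam(4), of "m / 100"] lam(1) by simp
  moreover have "\<forall>\<^sub>F k in sequentially. \<beta> k < 1 / 100"
    using order_tendstoD(2)[OF summable_LIMSEQ_zero[OF \<beta>(2)], of "1/100"] by simp
  ultimately have "\<forall>\<^sub>F k in sequentially. lam k \<le> 1 / (5 * L) \<and> \<bar>lam (Suc k) - lam k\<bar> \<le> lam k / 100 \<and> \<beta> k \<le> 1 / 100"
    using lam(3)
  proof eventually_elim
    case (elim k)
    then show ?case using lam(2)[of k] by (simp add: dist_real_def)
  qed
  then obtain N where N: "\<And>k. k \<ge> N \<Longrightarrow> lam k \<le> 1 / (5 * L)"
    "\<And>k. k \<ge> N \<Longrightarrow> \<bar>lam (Suc k) - lam k\<bar> \<le> lam k / 100" "\<And>k. k \<ge> N \<Longrightarrow> \<beta> k \<le> 1 / 100"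
    by (auto simp: eventually_sequentially)
  define a where "a z k = B z \<bullet> (x k - z)" for z k
  define V where "V z k = (norm (x (Suc k) - z))\<^sup>2 + 4 * lam k * a z k
      + 2/5 * (norm (x (Suc k) - u k))\<^sup>2 + 1/8 * (norm (u k - x k))\<^sup>2" for z k
  define G where "G z k = lam k * a z k + 1/20 * (norm (x (Suc k) - u k))\<^sup>2
      + 1/20 * (norm (u k - x k))\<^sup>2" for z k
  have a0: "a z k \<ge> 0" if "z \<in> ?S" for z k
    using that xC by (simp add: a_def vi_solutions_def)
  have V0: "V z k \<ge> 0" and G0: "G z k \<ge> 0" if "z \<in> ?S" for z k
    using a0[OF that, of k] lam0[of k] by (auto simp: V_def G_def)
  have step: "V z (Suc k) + G z k \<le> (1 + \<beta> (Suc k)) * V z k" if z: "z \<in> ?S" and k: "k \<ge> N" for z k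
    unfolding V_def G_def a_def
  proof (rule lyapunov_step[OF mon lip])
    show "lam (Suc k) * L \<le> 1/5" using N(1)[of "Suc k"] k L by (simp add: field_simps)
  qed (use proj xC w lam0 N k \<beta> z a0[OF z, of k] in \<open>auto simp: a_def vi_solutions_def\<close>)
  have fejer: "convergent (V z)" "G z \<longlonglongrightarrow> 0" if z: "z \<in> ?S" for z
  proof -
    have sb: "summable (\<lambda>k. \<beta> (Suc (k + N)))"
      using summable_ignore_initial_segment[OF \<beta>(2), of "Suc N"] by simp
    have st: "V z (Suc k + N) + G z (k + N) \<le> (1 + \<beta> (Suc (k + N))) * V z (k + N)" for k
      using step[OF z, of "k + N"] by simp
    note qf = quasi_fejer[of "\<lambda>k. V z (k + N)" "\<lambda>k. G z (k + N)" "\<lambda>k. \<beta> (Suc (k + N))",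
        OF V0[OF z] G0[OF z] \<beta>(1) sb st]
    show "convergent (V z)" using qf(1) by (simp add: convergent_ignore_initial_segment)
    show "G z \<longlonglongrightarrow> 0" using qf(2) by (rule LIMSEQ_offset)
  qed
  have parts: "(\<lambda>k. lam k * a z k) \<longlonglongrightarrow> 0" "(\<lambda>k. norm (x (Suc k) - u k)) \<longlonglongrightarrow> 0"
    "(\<lambda>k. norm (u k - x k)) \<longlonglongrightarrow> 0" if z: "z \<in> ?S" for z
  proof -
    have la: "0 \<le> lam k * a z k" for k using lam0[of k] a0[OF z, of k] by simp
    note s1 = sum_tendsto_zero_split[OF fejer(2)[OF z, unfolded G_def]]
    have A: "(\<lambda>k. lam k * a z k + 1/20 * (norm (x (Suc k) - u k))\<^sup>2) \<longlonglongrightarrow> 0"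
      "(\<lambda>k. 1/20 * (norm (u k - x k))\<^sup>2) \<longlonglongrightarrow> 0"
      using s1 la by simp_all
    note s2 = sum_tendsto_zero_split[OF A(1) la]
    show "(\<lambda>k. lam k * a z k) \<longlonglongrightarrow> 0" using s2(1) by simp
    show "(\<lambda>k. norm (x (Suc k) - u k)) \<longlonglongrightarrow> 0" "(\<lambda>k. norm (u k - x k)) \<longlonglongrightarrow> 0"
      using s2(2) A(2) by (auto intro: norm_square_tendsto_zero[where c = "1/20"])
  qed
  obtain z0 where z0: "z0 \<in> ?S" using S by blast
  note xu = parts(2)[OF z0] and ux = parts(3)[OF z0]
  \<comment> \<open>All terms of \<open>V z\<close> other than the squared distance tend to 0, so
    the distance inherits the limit.\<close>
  have conv: "convergent (\<lambda>k. (norm (x k - z))\<^sup>2)" if z: "z \<in> ?S" for z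
  proof -
    obtain l where "V z \<longlonglongrightarrow> l" using fejer(1)[OF z] by (auto simp: convergent_def)
    then have "(\<lambda>k. V z k - 4 * (lam k * a z k) - 2/5 * (norm (x (Suc k) - u k))\<^sup>2
        - 1/8 * (norm (u k - x k))\<^sup>2) \<longlonglongrightarrow> l - 4 * 0 - 2/5 * 0\<^sup>2 - 1/8 * 0\<^sup>2"
      by (intro tendsto_intros parts[OF z])
    then have "(\<lambda>k. (norm (x (Suc k) - z))\<^sup>2) \<longlonglongrightarrow> l" by (simp add: V_def)
    then have "(\<lambda>k. (norm (x k - z))\<^sup>2) \<longlonglongrightarrow> l" by (rule LIMSEQ_imp_Suc)
    then show ?thesis by (rule convergentI)
  qed
  have xx: "(\<lambda>k. norm (x (Suc k) - x k)) \<longlonglongrightarrow> 0"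
  proof (rule tendsto_sandwich[OF _ _ tendsto_const])
    show "(\<lambda>k. norm (x (Suc k) - u k) + norm (u k - x k)) \<longlonglongrightarrow> 0"
      using tendsto_add[OF xu ux] by simp
    show "\<forall>\<^sub>F k in sequentially. norm (x (Suc k) - x k) \<le> norm (x (Suc k) - u k) + norm (u k - x k)"
      using norm_triangle_ineq[of "x (Suc k) - u k" "u k - x k" for k] by simp
  qed simp
  obtain R where R: "\<And>k. norm (x k) \<le> R"
  proof -
    obtain r where "\<And>k. \<bar>(norm (x k - z0))\<^sup>2\<bar> \<le> r"
      using convergent_imp_Bseq[OF conv[OF z0]] by (auto simp: Bseq_def)
    then have "norm (x k - z0) \<le> sqrt r" for k
      by (intro real_le_rsqrt) simp
    then have "norm (x k) \<le> norm z0 + sqrt r" for k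
      using norm_triangle_sub[of "x k" z0] by (meson add_left_mono order_trans)
    then show ?thesis by (rule that)
  qed
  obtain R' where R': "\<And>k. norm (B (u k)) \<le> R'"
  proof -
    obtain r where r: "\<And>k. \<bar>norm (u k - x k)\<bar> \<le> r"
      using convergent_imp_Bseq[OF convergentI[OF ux]] by (auto simp: Bseq_def)
    have "norm (B (u k)) \<le> norm (B 0) + L * (r + R)" for k
    proof -
      have "norm (u k) \<le> r + R"
        using norm_triangle_ineq[of "u k - x k" "x k"] r[of k] R[of k] by simp
      then have "L * norm (u k) \<le> L * (r + R)" using L by (intro mult_left_mono) auto
      then show ?thesis
        using lipschitz_onD[OF lip, of "u k" 0] norm_triangle_ineq[of "B (u k) - B 0" "B 0"]
        by (simp add: dist_norm)
    qed
    then show ?thesis by (rule that)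
  qed
  have cluster: "p \<in> ?S" if p: "\<And>n. p \<in> closure (convex hull (x ` {n..}))" for p
  proof (rule minty[OF C(3)])
    show "continuous_on UNIV B" using lip by (rule lipschitz_on_continuous_on)
    show "p \<in> C" by (rule tail_hull_in_closed_convex[OF p C(2,3)]) (simp add: xC)
    fix y assume y: "y \<in> C"
    \<comment> \<open>The error in the weak inequality at \<open>x (Suc k)\<close>: the first term
      comes from the projection inequality divided by \<open>lam k \<ge> m\<close>, the second from
      replacing \<open>B (u k)\<close> by \<open>B y\<close> through monotonicity at
      \<open>u k\<close> instead of \<open>x (Suc k)\<close>.\<close>
    define \<eta> where "\<eta> k = (norm y + R) / m * norm (x (Suc k) - x k)
        + (R' + norm (B y)) * norm (x (Suc k) - u k)" for k
    have lower: "- \<eta> k \<le> B y \<bullet> (y - x (Suc k))" for k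
    proof -
      let ?d = "x (Suc k) - x k" and ?v = "y - x (Suc k)" and ?e = "x (Suc k) - u k"
      have "0 \<le> ?d \<bullet> ?v + lam k * (B (u k) \<bullet> ?v)"
        using proj[OF y, of k] by (simp add: inner_simps algebra_simps)
      moreover have "?d \<bullet> ?v \<le> norm ?d * (norm y + R)"
      proof -
        have "norm ?v \<le> norm y + R"
          using norm_triangle_ineq4[of y "x (Suc k)"] R[of "Suc k"] by linarith
        from mult_left_mono[OF this norm_ge_zero[of ?d]] norm_cauchy_schwarz[of ?d ?v]
        show ?thesis by linarith
      qed
      ultimately have "- (B (u k) \<bullet> ?v) \<le> norm ?d * (norm y + R) / lam k"
        using lam0[of k] by (simp add: pos_le_divide_eq mult.commute)
      also have "\<dots> \<le> norm ?d * (norm y + R) / m"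
        using lam(1) lam(2)[of k] lam0[of k] order_trans[OF norm_ge_zero R[of 0]]
        by (intro divide_left_mono) auto
      finally have "- (B (u k) \<bullet> ?v) \<le> (norm y + R) / m * norm ?d" by (simp add: mult.commute)
      moreover have "0 \<le> (B y - B (u k)) \<bullet> (y - u k)" using mon by (simp add: monotone_operator_def)
      moreover have "B y \<bullet> ?e \<le> norm (B y) * norm ?e" by (rule norm_cauchy_schwarz)
      moreover have "- (B (u k) \<bullet> ?e) \<le> R' * norm ?e"
        using norm_cauchy_schwarz[of "- B (u k)" ?e] mult_right_mono[OF R'[of k] norm_ge_zero[of ?e]] by simp
      ultimately show ?thesis by (simp add: \<eta>_def inner_diff_left inner_diff_right distrib_right)
    qed
    have "\<eta> \<longlonglongrightarrow> (norm y + R) / m * 0 + (R' + norm (B y)) * 0"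
      unfolding \<eta>_def by (intro tendsto_intros xx xu)
    then have \<eta>: "\<eta> \<longlonglongrightarrow> 0" by simp
    \<comment> \<open>With slack \<open>e\<close> the inequality puts late iterates in a closed
      half-space, which therefore contains \<open>p\<close>.\<close>
    have le: "- e \<le> B y \<bullet> (y - p)" if "e > 0" for e
    proof -
      have "\<forall>\<^sub>F k in sequentially. \<eta> k < e" using order_tendstoD(2)[OF \<eta> that] .
      then have "\<forall>\<^sub>F k in sequentially. x (Suc k) \<in> {v. B y \<bullet> v \<le> B y \<bullet> y + e}"
      proof eventually_elim
        case (elim k)
        then show ?case using lower[of k] by (simp add: inner_diff_right)
      qed
      then have "\<forall>\<^sub>F k in sequentially. x k \<in> {v. B y \<bullet> v \<le> B y \<bullet> y + e}"
        by (rule eventually_sequentially_Suc[THEN iffD1])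
      from tail_hull_in_closed_convex[OF p closed_halfspace_le convex_halfspace_le this]
      show ?thesis by (simp add: inner_diff_right)
    qed
    then show "0 \<le> B y \<bullet> (y - p)" using field_le_epsilon[of 0 "B y \<bullet> (y - p)"] by fastforce
  qed
  have "bounded (range x)" using R by (auto simp: bounded_iff)
  from weakly_converges_if_tail_hulls[OF this cluster conv] xx ux show ?thesis by blast
qed

section \<open>Application to the safeguarded ratio rule\<close>

theorem theorem8p4:
  fixes B :: "'a::{real_inner, complete_space} \<Rightarrow> 'a"
    and C :: "'a set"
    and L \<kappa> :: real
    and \<beta> \<theta> \<omega> lam :: "nat \<Rightarrow> real"
    and x u :: "nat \<Rightarrow> 'a"
  assumes "C \<noteq> {}" and "closed C" and "convex C"
    and "monotone_operator B"
    and "L > 0" and "L-lipschitz_on UNIV B"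
    and "vi_solutions B C \<noteq> {}"
    and "\<And>k. 0 \<le> \<beta> k" and "\<And>k. \<beta> k \<le> 1/4" and "summable \<beta>"
    and "\<And>k. \<theta> k = 1 - \<beta> k"
    and "x 0 = u 0" and "u 0 \<in> C"
    and "\<And>k. x (Suc k) = metric_proj C (x k - lam k *\<^sub>R B (u k))"
    and "\<And>k. k \<ge> 1 \<Longrightarrow>
          u k = x k + \<theta> k *\<^sub>R (x k - x (k - 1)) + \<beta> k *\<^sub>R (x k - u (k - 1))"
    and "lam 0 > 0" and "0 < \<kappa>" and "\<kappa> \<le> 1/6"
    and "\<And>k. 0 \<le> \<omega> k" and "summable \<omega>"
    and "safeguarded_ratio_rule \<kappa> \<omega> B u lam"
  shows
    "let conclusion =
          (\<exists>z\<in>vi_solutions B C. weakly_converges x z)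
          \<and> (\<lambda>k. norm (x (Suc k) - x k)) \<longlonglongrightarrow> 0
          \<and> (\<lambda>k. norm (u k - x k)) \<longlonglongrightarrow> 0
     in (summable (\<lambda>k. \<bar>lam (Suc k) - lam k\<bar>) \<and> (\<exists>K. \<forall>k\<ge>K. lam k \<le> 1 / (5 * L))
          \<longrightarrow> conclusion)
      \<and> (summable (\<lambda>k. \<bar>lam (Suc k) - lam k\<bar>) \<and> lam 0 \<le> 1 / (5 * L)
          \<longrightarrow> conclusion)
      \<and> (lam 0 \<le> 1 / (5 * L) \<and> (\<forall>k. \<omega> k = 0)
          \<longrightarrow> (\<forall>k. lam k \<le> 1 / (5 * L)) \<and> conclusion)"
proof -
  define m where "m = min (lam 0) (\<kappa> / L)"
  define conclusion where "conclusion \<longleftrightarrow> (\<exists>z\<in>vi_solutions B C. weakly_converges x z)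
          \<and> (\<lambda>k. norm (x (Suc k) - x k)) \<longlonglongrightarrow> 0
          \<and> (\<lambda>k. norm (u k - x k)) \<longlonglongrightarrow> 0"
  have m: "m > 0" "m \<le> lam k" for k
    using assms(5,16,17) safeguarded_ratio_rule_lower_bound[OF assms(21,6,5,16,17,19)]
    by (auto simp: m_def)
  \<comment> \<open>Substituting \<open>\<theta> = 1 - \<beta>\<close> cancels all but one multiple
    of the previous offset \<open>u k - x k\<close>.\<close>
  have w: "u (Suc k) - x (Suc k) = (x (Suc k) - x k) - \<beta> (Suc k) *\<^sub>R (u k - x k)" for k
    using assms(15)[of "Suc k"] by (simp add: assms(11) algebra_simps)
  have main: conclusion
    if "summable (\<lambda>k. \<bar>lam (Suc k) - lam k\<bar>)" "\<exists>K. \<forall>k\<ge>K. lam k \<le> 1 / (5 * L)"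
    unfolding conclusion_def
  proof (rule reflected_projection_weakly_converges[OF assms(1-8,10) _ assms(14) w m])
    show "\<forall>\<^sub>F k in sequentially. lam k \<le> 1 / (5 * L)" using that(2) by (simp add: eventually_sequentially)
    show "(\<lambda>k. lam (Suc k) - lam k) \<longlonglongrightarrow> 0"
      using summable_LIMSEQ_zero[OF that(1)] by (simp add: tendsto_rabs_zero_iff)
  qed (use assms(12,13) in simp)
  \<comment> \<open>The cap at \<open>lam 0\<close> in the rule makes a bound on the initial step
    hold from index 0 on.\<close>
  have le0: "lam k \<le> lam 0" for k
    using assms(21) by (cases k) (auto simp: safeguarded_ratio_rule_def)
  \<comment> \<open>Without growth the steps decrease and stay above \<open>m\<close>, so their
    increments telescope to a finite sum.\<close>
  have fixed: "summable (\<lambda>k. \<bar>lam (Suc k) - lam k\<bar>)" if "\<forall>k. \<omega> k = 0"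
    using decseq_bounded_below_summable_abs_diff[OF safeguarded_ratio_rule_decseq[OF assms(21)] m(2)] that
    by blast
  show ?thesis
    unfolding Let_def conclusion_def[symmetric] using main fixed order_trans[OF le0] by blast
qed

end
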